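(* Let $\mathfrak{o}$ be a principal ideal domain and let $\mathfrak{a}_1,\mathfrak{a}_2,\mathfrak{b}_1,\mathfrak{b}_2,\mathfrak{c}_1,\mathfrak{c}_2$ be nonzero ideals of $\mathfrak{o}$. The triple $((\mathfrak{a}_1,\mathfrak{a}_2),(\mathfrak{b}_1,\mathfrak{b}_2),(\mathfrak{c}_1,\mathfrak{c}_2))$ is realisable if and only if the following conditions are satisfied: (1) $\mathfrak{a}_1^2 \mid \mathfrak{a}_2$, $\mathfrak{b}_1^2 \mid \mathfrak{b}_2$ and $\mathfrak{c}_1^2 \mid \mathfrak{c}_2$. (2) $\mathfrak{a}_2\mathfrak{b}_2 = \mathfrak{c}_2$. (3) $\mathfrak{a}_1\mathfrak{b}_1 \mid \mathfrak{c}_1$ and $\mathfrak{c}_1 \mid \mathfrak{a}_1\mathfrak{b}_1\left(\mathfrak{a}_1^{-2}\mathfrak{a}_2 + \mathfrak{b}_1^{-2}\mathfrak{b}_2\right)$.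
   Context: $I_2$ denotes the set of $2 \times 2$ matrices with entries in $\mathfrak{o}$ and non-zero determinant. For $A \in \mathfrak{o}^{2\times 2}$, the determinantal divisors are: $\mathfrak{d}_1(A)$, the ideal of $\mathfrak{o}$ generated by all entries of $A$, and $\mathfrak{d}_2(A)$, the ideal generated by $\det A$. The triple $((\mathfrak{a}_1,\mathfrak{a}_2),(\mathfrak{b}_1,\mathfrak{b}_2),(\mathfrak{c}_1,\mathfrak{c}_2))$ is called realisable if there exist matrices $A, B \in I_2$ such that $\mathfrak{d}_k(A)=\mathfrak{a}_k$, $\mathfrak{d}_k(B)=\mathfrak{b}_k$ and $\mathfrak{d}_k(AB)=\mathfrak{c}_k$ for $k=1,2$. Inverses, products and sums are those of fractional ideals in the field of fractions of $\mathfrak{o}$, and for fractional ideals $\mathfrak{a} \mid \mathfrak{b}$ means $\mathfrak{b} \subseteq \mathfrak{a}$. *)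

theory Defs
  imports "HOL-Analysis.Determinants" "HOL-Computational_Algebra.Fraction_Field"
begin

text \<open>Ideals of a commutative ring are its submodules when it is regarded as a module over itself.\<close>

lemma module_self: "module ((*) :: 'a::comm_ring_1 \<Rightarrow> 'a \<Rightarrow> 'a)"
  by unfold_locales (simp_all add: algebra_simps)

definition is_ideal :: "'a::comm_ring_1 set \<Rightarrow> bool" where
  "is_ideal = module.subspace (*)"

definition ideal_generated :: "'a::comm_ring_1 set \<Rightarrow> 'a set" where
  "ideal_generated = module.span (*)"

definition principal_ideal_domain :: "'a::idom itself \<Rightarrow> bool" where
  "principal_ideal_domain _ \<longleftrightarrow>
     (\<forall>I :: 'a set. is_ideal I \<longrightarrow> (\<exists>g. I = ideal_generated {g}))"

definition I\<^sub>2 :: "('a::comm_ring_1 ^ 2 ^ 2) set" where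
  "I\<^sub>2 = {A. det A \<noteq> 0}"

definition det_div1 :: "'a::comm_ring_1 ^ 2 ^ 2 \<Rightarrow> 'a set" where
  "det_div1 A = ideal_generated {A $ i $ j | i j. True}"

definition det_div2 :: "'a::comm_ring_1 ^ 2 ^ 2 \<Rightarrow> 'a set" where
  "det_div2 A = ideal_generated {det A}"

definition realisable ::
  "('a::comm_ring_1 set \<times> 'a set) \<times> ('a set \<times> 'a set) \<times> ('a set \<times> 'a set) \<Rightarrow> bool" where
  "realisable = (\<lambda>((\<aa>1, \<aa>2), (\<bb>1, \<bb>2), (\<cc>1, \<cc>2)).
     \<exists>A \<in> I\<^sub>2. \<exists>B \<in> I\<^sub>2.
       det_div1 A = \<aa>1 \<and> det_div2 A = \<aa>2 \<and>
       det_div1 B = \<bb>1 \<and> det_div2 B = \<bb>2 \<and>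
       det_div1 (A ** B) = \<cc>1 \<and> det_div2 (A ** B) = \<cc>2)"

text \<open>
  Fractional ideals are represented as subsets of the field of fractions. The integral ideal
  \<open>I\<close> is identified with its image \<open>frac_ideal I\<close>.
\<close>

definition embed :: "'a::idom \<Rightarrow> 'a fract" where
  "embed r = Fraction_Field.Fract r 1"

definition frac_ideal :: "'a::idom set \<Rightarrow> 'a fract set" where
  "frac_ideal I = embed ` I"

lemma module_fract: "module (\<lambda>(r::'a::idom) (x::'a fract). embed r * x)"
proof -
  have "embed (r + s) = embed r + embed s" "embed (r * s) = embed r * embed s"
    "embed 1 = (1 :: 'a fract)" for r s :: 'a
    by (simp_all add: embed_def Fraction_Field.One_fract_def)
  then show ?thesis
    by unfold_locales (simp_all add: algebra_simps)
qed

definition frac_mult :: "'a::idom fract set \<Rightarrow> 'a fract set \<Rightarrow> 'a fract set"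
    (infixl "*\<^sub>f" 70) where
  "I *\<^sub>f J = module.span (\<lambda>(r::'a) x. embed r * x) {x * y | x y. x \<in> I \<and> y \<in> J}"

definition frac_add :: "'a::idom fract set \<Rightarrow> 'a fract set \<Rightarrow> 'a fract set"
    (infixl "+\<^sub>f" 65) where
  "I +\<^sub>f J = {x + y | x y. x \<in> I \<and> y \<in> J}"

text \<open>The colon ideal; over a principal ideal domain it is the group-theoretic inverse of every
  nonzero fractional ideal.\<close>

definition frac_inv :: "'a::idom fract set \<Rightarrow> 'a fract set" where
  "frac_inv I = {x. \<forall>y \<in> I. x * y \<in> range embed}"

text \<open>Integer powers, with \<open>I\<^sup>-\<^sup>n\<close> meaning the \<open>n\<close>-th power of the inverse of \<open>I\<close>.\<close>

primrec frac_pow :: "'a::idom fract set \<Rightarrow> nat \<Rightarrow> 'a fract set" where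
  "frac_pow I 0 = range embed"
| "frac_pow I (Suc n) = I *\<^sub>f frac_pow I n"

definition frac_powi :: "'a::idom fract set \<Rightarrow> int \<Rightarrow> 'a fract set" (infixr "^\<^sub>f" 80) where
  "I ^\<^sub>f k = (if k \<ge> 0 then frac_pow I (nat k) else frac_pow (frac_inv I) (nat (- k)))"

definition frac_dvd :: "'a::idom fract set \<Rightarrow> 'a fract set \<Rightarrow> bool" (infix "dvd\<^sub>f" 50) where
  "I dvd\<^sub>f J \<longleftrightarrow> J \<subseteq> I"

end

theory Submission
  imports Defs
begin

text \<open>
  Every nonzero ideal is principal, so all six ideals are replaced by generators
  \<open>a\<^sub>1, a\<^sub>2, b\<^sub>1, b\<^sub>2, c\<^sub>1, c\<^sub>2\<close>. Every fractional ideal in the statement is then a cyclic submodule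
  \<open>\<langle>x\<rangle>\<close> of the field of fractions, or a sum of two such, and the three conditions become
  divisibilities between the generators. In the last one no generator of the sum is needed: an ideal
  divides a sum if and only if it divides both summands, and after clearing denominators this says
  \<open>c\<^sub>1 a\<^sub>1 dvd b\<^sub>1 a\<^sub>2\<close> and \<open>c\<^sub>1 b\<^sub>1 dvd a\<^sub>1 b\<^sub>2\<close>.

  Necessity: entries of a product are divisible by the product of the gcds of the factors, and the
  determinant of a matrix is divisible by the square of the gcd of its entries. The upper bound on
  \<open>c\<^sub>1\<close> comes from the adjugate: in \<open>adj A \<cdot> (A B) = det A \<cdot> B\<close> the left-hand side has all entries
  divisible by \<open>a\<^sub>1 c\<^sub>1\<close>, and \<open>b\<^sub>1\<close> is a linear combination of the entries of \<open>B\<close>, so \<open>a\<^sub>1 c\<^sub>1\<close> divides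
  \<open>det A \<cdot> b\<^sub>1\<close> (lemma \<open>det_mult_entry_dvd\<close>). Transposition gives the bound with the roles
  of \<open>A\<close> and \<open>B\<close> exchanged.

  Sufficiency: write \<open>a\<^sub>2 = a\<^sub>1\<^sup>2 \<alpha>\<close>, \<open>b\<^sub>2 = b\<^sub>1\<^sup>2 \<beta>\<close> and \<open>c\<^sub>1 = a\<^sub>1 b\<^sub>1 d\<close>. The upper bound on \<open>c\<^sub>1\<close> says that
  \<open>d\<close> divides both \<open>\<alpha>\<close> and \<open>\<beta> = d \<gamma>\<close>. The matrices \<open>A\<close> with rows \<open>a\<^sub>1 (1, 0)\<close> and \<open>a\<^sub>1 (0, \<alpha>)\<close>,
  and \<open>B\<close> with rows \<open>b\<^sub>1 (d, 0)\<close> and \<open>b\<^sub>1 (1, \<gamma>)\<close>, have the product with rows \<open>a\<^sub>1 b\<^sub>1 (d, 0)\<close> and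
  \<open>a\<^sub>1 b\<^sub>1 (\<alpha>, \<alpha> \<gamma>)\<close>, and each of the three matrices contains the gcd of its entries as an entry.
\<close>

section \<open>Principal ideals and determinantal divisors\<close>

lemma ideal_generated_singleton: "ideal_generated {g} = {x::'a::comm_ring_1. g dvd x}"
  unfolding ideal_generated_def module.span_singleton[OF module_self]
  by (auto simp: dvd_def mult.commute)

lemma ideal_generated_singleton_eq_iff:
  "ideal_generated {g} = ideal_generated {h} \<longleftrightarrow> g dvd h \<and> h dvd (g::'a::comm_ring_1)"
  unfolding ideal_generated_singleton set_eq_iff mem_Collect_eq by (metis dvd_refl dvd_trans)

lemma det_div1_eqD:
  assumes "det_div1 A = ideal_generated {g}"
  shows "g dvd A $ i $ j"
proof -
  have "A $ i $ j \<in> det_div1 A"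
    unfolding det_div1_def ideal_generated_def
    by (rule module.span_base[OF module_self]) auto
  then show ?thesis
    using assms by (simp add: ideal_generated_singleton)
qed

text \<open>This is how the fact that \<open>g\<close> is a linear combination of the entries gets used: the elements
  \<open>z\<close> with \<open>x dvd y * z\<close> form an ideal, which contains \<open>g\<close> once it contains the entries.\<close>

lemma dvd_mult_generator:
  assumes gen: "det_div1 A = ideal_generated {g}" and dvd: "\<And>i j. x dvd y * A $ i $ j"
  shows "x dvd y * g"
proof -
  have "module.subspace (*) {z. x dvd y * z}"
    by (rule module.subspaceI[OF module_self])
       (auto simp: distrib_left mult.left_commute[of y])
  then have "det_div1 A \<subseteq> {z. x dvd y * z}"
    unfolding det_div1_def ideal_generated_def
    by (intro module.span_minimal[OF module_self]) (use dvd in auto)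
  moreover have "g \<in> det_div1 A"
    by (simp add: gen ideal_generated_singleton)
  ultimately show ?thesis by auto
qed

lemma det_div1_eq_entry:
  assumes "\<And>k l. A $ i $ j dvd A $ k $ l"
  shows "det_div1 A = ideal_generated {A $ i $ j}"
proof
  have "module.subspace (*) {z. A $ i $ j dvd z}"
    by (rule module.subspaceI[OF module_self]) auto
  then show "det_div1 A \<subseteq> ideal_generated {A $ i $ j}"
    unfolding det_div1_def ideal_generated_singleton unfolding ideal_generated_def
    by (intro module.span_minimal[OF module_self]) (use assms in auto)
  show "ideal_generated {A $ i $ j} \<subseteq> det_div1 A"
    unfolding det_div1_def ideal_generated_def
    by (rule module.span_mono[OF module_self]) auto
qed

lemma det_div1_transpose: "det_div1 (transpose A) = det_div1 A"
  unfolding det_div1_def transpose_def by (rule arg_cong[of _ _ ideal_generated]) auto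

section \<open>Divisibility in products of matrices\<close>

lemma matrix_mult_entry:
  fixes A B :: "'a::comm_ring_1 ^ 2 ^ 2"
  shows "(A ** B) $ i $ j = A $ i $ 1 * B $ 1 $ j + A $ i $ 2 * B $ 2 $ j"
  by (simp add: matrix_matrix_mult_def sum_2)

lemma square_dvd_det:
  fixes A :: "'a::comm_ring_1 ^ 2 ^ 2"
  assumes "\<And>i j. g dvd A $ i $ j"
  shows "g\<^sup>2 dvd det A"
  unfolding det_2 power2_eq_square by (intro dvd_diff mult_dvd_mono assms)

text \<open>The entries of \<open>adj A \<cdot> (A B) = det A \<cdot> B\<close>, where the adjugate has, up to sign, the same entries
  as \<open>A\<close>.\<close>

lemma det_mult_entry_dvd:
  fixes A B :: "'a::comm_ring_1 ^ 2 ^ 2"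
  assumes A: "\<And>i j. g dvd A $ i $ j" and AB: "\<And>i j. h dvd (A ** B) $ i $ j"
  shows "g * h dvd det A * B $ i $ j"
proof -
  have 1: "det A * B $ 1 $ j = A $ 2 $ 2 * (A ** B) $ 1 $ j - A $ 1 $ 2 * (A ** B) $ 2 $ j"
    by (simp add: matrix_mult_entry det_2 algebra_simps)
  have 2: "det A * B $ 2 $ j = A $ 1 $ 1 * (A ** B) $ 2 $ j - A $ 2 $ 1 * (A ** B) $ 1 $ j"
    by (simp add: matrix_mult_entry det_2 algebra_simps)
  have "g * h dvd det A * B $ 1 $ j" "g * h dvd det A * B $ 2 $ j"
    unfolding 1 2 by (intro dvd_diff mult_dvd_mono A AB)+
  then show ?thesis
    using exhaust_2[of i] by auto
qed

section \<open>Realisability in terms of generators\<close>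

lemma realisable_imp_dvd:
  fixes a1 a2 b1 b2 c1 c2 :: "'a::comm_ring_1"
  assumes "realisable ((ideal_generated {a1}, ideal_generated {a2}),
    (ideal_generated {b1}, ideal_generated {b2}), (ideal_generated {c1}, ideal_generated {c2}))"
  shows "a1\<^sup>2 dvd a2" "b1\<^sup>2 dvd b2" "c1\<^sup>2 dvd c2"
    and "ideal_generated {a2 * b2} = ideal_generated {c2}"
    and "a1 * b1 dvd c1" "c1 * a1 dvd b1 * a2" "c1 * b1 dvd a1 * b2"
proof -
  obtain A B :: "'a ^ 2 ^ 2" where
    A: "det_div1 A = ideal_generated {a1}" and A2: "det_div2 A = ideal_generated {a2}" and
    B: "det_div1 B = ideal_generated {b1}" and B2: "det_div2 B = ideal_generated {b2}" and
    C: "det_div1 (A ** B) = ideal_generated {c1}" and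
    C2: "det_div2 (A ** B) = ideal_generated {c2}"
    using assms by (auto simp: realisable_def)
  note a = det_div1_eqD[OF A] and b = det_div1_eqD[OF B] and c = det_div1_eqD[OF C]
  have a2: "det A dvd a2" "a2 dvd det A" and b2: "det B dvd b2" "b2 dvd det B"
    and c2: "det (A ** B) dvd c2" "c2 dvd det (A ** B)"
    using A2 B2 C2 by (simp_all add: det_div2_def ideal_generated_singleton_eq_iff)
  show "a1\<^sup>2 dvd a2" "b1\<^sup>2 dvd b2" "c1\<^sup>2 dvd c2"
    by (rule dvd_trans[OF square_dvd_det[OF a] a2(1)] dvd_trans[OF square_dvd_det[OF b] b2(1)]
        dvd_trans[OF square_dvd_det[OF c] c2(1)])+
  have "det A * det B dvd c2" "c2 dvd det A * det B"
    using c2 by (simp_all add: det_mul)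
  then show "ideal_generated {a2 * b2} = ideal_generated {c2}"
    unfolding ideal_generated_singleton_eq_iff
    using mult_dvd_mono[OF a2(1) b2(1)] mult_dvd_mono[OF a2(2) b2(2)] by (blast intro: dvd_trans)
  have "a1 * b1 dvd 1 * (A ** B) $ i $ j" for i j
    unfolding matrix_mult_entry mult_1 by (intro dvd_add mult_dvd_mono a b)
  from dvd_mult_generator[OF C this] show "a1 * b1 dvd c1"
    by simp
  have "a1 * c1 dvd det A * b1"
    by (rule dvd_mult_generator[OF B]) (intro det_mult_entry_dvd a c)
  moreover have "det A * b1 dvd a2 * b1"
    using a2 by (intro mult_dvd_mono) auto
  ultimately show "c1 * a1 dvd b1 * a2"
    by (metis dvd_trans mult.commute)
  \<comment> \<open>Transposition swaps the factors of \<open>A ** B\<close>, so the same argument bounds \<open>c1\<close> by \<open>b2\<close>.\<close>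
  have "b1 * c1 dvd det (transpose B) * transpose A $ i $ j" for i j
  proof (rule det_mult_entry_dvd)
    show "b1 dvd transpose B $ i $ j" for i j
      by (simp add: transpose_def b)
    show "c1 dvd (transpose B ** transpose A) $ i $ j" for i j
      unfolding matrix_transpose_mul[symmetric] by (simp add: transpose_def c)
  qed
  then have "b1 * c1 dvd det (transpose B) * a1"
    by (rule dvd_mult_generator[OF trans[OF det_div1_transpose A]])
  moreover have "det (transpose B) * a1 dvd b2 * a1"
    using b2 by (intro mult_dvd_mono) (auto simp: det_transpose)
  ultimately show "c1 * b1 dvd a1 * b2"
    by (metis dvd_trans mult.commute)
qed

lemma dvd_imp_realisable:
  fixes a1 a2 b1 b2 c1 c2 :: "'a::idom"
  assumes nz: "a1 \<noteq> 0" "a2 \<noteq> 0" "b1 \<noteq> 0" "b2 \<noteq> 0"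
    and sq: "a1\<^sup>2 dvd a2" "b1\<^sup>2 dvd b2"
    and c2: "ideal_generated {a2 * b2} = ideal_generated {c2}"
    and low: "a1 * b1 dvd c1" and up: "c1 * a1 dvd b1 * a2" "c1 * b1 dvd a1 * b2"
  shows "realisable ((ideal_generated {a1}, ideal_generated {a2}),
    (ideal_generated {b1}, ideal_generated {b2}), (ideal_generated {c1}, ideal_generated {c2}))"
proof -
  obtain \<alpha> \<beta> d where a2: "a2 = a1\<^sup>2 * \<alpha>" and b2: "b2 = b1\<^sup>2 * \<beta>" and c1: "c1 = a1 * b1 * d"
    using sq low by (auto elim!: dvdE)
  have "(a1\<^sup>2 * b1) * d dvd (a1\<^sup>2 * b1) * \<alpha>" "(a1 * b1\<^sup>2) * d dvd (a1 * b1\<^sup>2) * \<beta>"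
    using up by (simp_all add: a2 b2 c1 power2_eq_square mult_ac)
  then have d: "d dvd \<alpha>" "d dvd \<beta>"
    using nz by simp_all
  obtain \<gamma> where \<gamma>: "\<beta> = d * \<gamma>"
    using d by (auto elim: dvdE)
  define A B :: "'a ^ 2 ^ 2"
    where "A = vector [vector [a1, 0], vector [0, a1 * \<alpha>]]"
      and "B = vector [vector [b1 * d, 0], vector [b1, b1 * \<gamma>]]"
  have detA: "det A = a2" and detB: "det B = b2"
    by (simp_all add: A_def B_def det_2 a2 b2 \<gamma> power2_eq_square)
  have "\<forall>i j. A $ 1 $ 1 dvd A $ i $ j" "\<forall>i j. B $ 2 $ 1 dvd B $ i $ j"
    by (simp_all add: A_def B_def forall_2)
  then have "det_div1 A = ideal_generated {A $ 1 $ 1}" "det_div1 B = ideal_generated {B $ 2 $ 1}"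
    by (simp_all add: det_div1_eq_entry)
  then have A1: "det_div1 A = ideal_generated {a1}" and B1: "det_div1 B = ideal_generated {b1}"
    by (simp_all add: A_def B_def)
  have AB: "(A ** B) $ 1 $ 1 = c1" "(A ** B) $ 1 $ 2 = 0"
    "(A ** B) $ 2 $ 1 = a1 * b1 * \<alpha>" "(A ** B) $ 2 $ 2 = a1 * b1 * (\<alpha> * \<gamma>)"
    by (simp_all add: matrix_mult_entry A_def B_def c1)
  have "c1 dvd (A ** B) $ i $ j" for i j
  proof -
    have "c1 dvd a1 * b1 * \<alpha>" "c1 dvd a1 * b1 * (\<alpha> * \<gamma>)"
      using d by (simp_all add: c1)
    then show ?thesis
      using exhaust_2[of i] exhaust_2[of j] AB by auto
  qed
  then have C1: "det_div1 (A ** B) = ideal_generated {c1}"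
    using det_div1_eq_entry[of "A ** B" 1 1] AB by simp
  have "A \<in> I\<^sub>2" "B \<in> I\<^sub>2"
    using nz by (simp_all add: I\<^sub>2_def detA detB)
  moreover have "det_div2 A = ideal_generated {a2}" "det_div2 B = ideal_generated {b2}"
    "det_div2 (A ** B) = ideal_generated {c2}"
    by (simp_all add: det_div2_def det_mul detA detB c2)
  ultimately show ?thesis
    unfolding realisable_def prod.case using A1 B1 C1 by blast
qed

section \<open>Cyclic fractional ideals\<close>

lemma embed_simps:
  "embed 0 = (0 :: 'a::idom fract)" "embed 1 = (1 :: 'a fract)"
  "embed (r + s) = embed r + (embed s :: 'a fract)"
  "embed (r * s) = embed r * (embed s :: 'a fract)"
  by (simp_all add: embed_def Fraction_Field.One_fract_def Fraction_Field.Zero_fract_def)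

lemma embed_eq_iff [simp]: "embed r = embed s \<longleftrightarrow> r = s"
  by (simp add: embed_def eq_fract)

definition cyclic :: "'a::idom fract \<Rightarrow> 'a fract set" where
  "cyclic x = range (\<lambda>r. embed r * x)"

lemma mem_cyclic_embed_iff: "embed h \<in> cyclic (embed g) \<longleftrightarrow> g dvd h"
  by (auto simp: cyclic_def dvd_def mult.commute simp flip: embed_simps)

lemma subspace_cyclic: "module.subspace (\<lambda>r. (*) (embed r)) (cyclic x)"
  unfolding cyclic_def module.span_singleton[OF module_fract, symmetric]
  by (rule module.subspace_span[OF module_fract])

lemma subspace_frac_add:
  assumes "module.subspace (\<lambda>r. (*) (embed r)) I" "module.subspace (\<lambda>r. (*) (embed r)) J"
  shows "module.subspace (\<lambda>r. (*) (embed r)) (I +\<^sub>f J)"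
proof (rule module.subspaceI[OF module_fract])
  have "0 + 0 \<in> I +\<^sub>f J"
    unfolding frac_add_def using assms[THEN module.subspace_0[OF module_fract]] by blast
  then show "0 \<in> I +\<^sub>f J" by simp
next
  fix x y assume "x \<in> I +\<^sub>f J" "y \<in> I +\<^sub>f J"
  then obtain u v u' v' where "u \<in> I" "v \<in> J" "x = u + v" "u' \<in> I" "v' \<in> J" "y = u' + v'"
    by (auto simp: frac_add_def)
  moreover from this have "x + y = (u + u') + (v + v')"
    by (simp add: algebra_simps)
  ultimately show "x + y \<in> I +\<^sub>f J"
    using assms[THEN module.subspace_add[OF module_fract]] unfolding frac_add_def
    by (intro CollectI exI[of _ "u + u'"] exI[of _ "v + v'"]) simp
next
  fix r x assume "x \<in> I +\<^sub>f J"
  then obtain u v where "u \<in> I" "v \<in> J" "embed r * x = embed r * u + embed r * v"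
    by (auto simp: frac_add_def distrib_left)
  then show "embed r * x \<in> I +\<^sub>f J"
    using assms[THEN module.subspace_scale[OF module_fract]] unfolding frac_add_def
    by (intro CollectI exI[of _ "embed r * u"] exI[of _ "embed r * v"]) simp
qed

lemma frac_ideal_singleton: "frac_ideal (ideal_generated {g}) = cyclic (embed g)"
  unfolding frac_ideal_def ideal_generated_def module.span_singleton[OF module_self] cyclic_def
  by (auto simp: embed_simps image_image)

lemma cyclic_dvd_iff:
  assumes "module.subspace (\<lambda>r. (*) (embed r)) I"
  shows "I dvd\<^sub>f cyclic x \<longleftrightarrow> x \<in> I"
proof -
  have "x \<in> cyclic x"
    by (auto simp: cyclic_def intro: range_eqI[of _ _ 1] simp: embed_simps)
  then show ?thesis
    using module.subspace_scale[OF module_fract assms]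
    by (auto simp: frac_dvd_def cyclic_def)
qed

lemma dvd_cyclic_add_iff:
  assumes I: "module.subspace (\<lambda>r. (*) (embed r)) I"
  shows "I dvd\<^sub>f cyclic x +\<^sub>f cyclic y \<longleftrightarrow> x \<in> I \<and> y \<in> I"
proof
  assume "I dvd\<^sub>f cyclic x +\<^sub>f cyclic y"
  moreover have "embed 1 * x + embed 0 * y \<in> cyclic x +\<^sub>f cyclic y"
    "embed 0 * x + embed 1 * y \<in> cyclic x +\<^sub>f cyclic y"
    unfolding frac_add_def cyclic_def by blast+
  ultimately show "x \<in> I \<and> y \<in> I"
    by (auto simp: frac_dvd_def embed_simps)
next
  assume "x \<in> I \<and> y \<in> I"
  then show "I dvd\<^sub>f cyclic x +\<^sub>f cyclic y"
    using module.subspace_add[OF module_fract I] module.subspace_scale[OF module_fract I]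
    by (auto simp: frac_dvd_def frac_add_def cyclic_def)
qed

text \<open>Multiplication by a cyclic module is multiplication by its generator: the products already form
  a submodule, so taking the span adds nothing.\<close>

lemma cyclic_frac_mult:
  assumes J: "module.subspace (\<lambda>r. (*) (embed r)) J"
  shows "cyclic x *\<^sub>f J = (*) x ` J"
proof -
  have prods: "{u * v | u v. u \<in> cyclic x \<and> v \<in> J} = (*) x ` J"
  proof (intro equalityI subsetI)
    fix w assume "w \<in> {u * v | u v. u \<in> cyclic x \<and> v \<in> J}"
    then obtain r v where "w = embed r * x * v" "v \<in> J"
      by (auto simp: cyclic_def)
    then have "w = x * (embed r * v)" "v \<in> J"
      by (simp_all add: mult_ac)
    then show "w \<in> (*) x ` J"
      using module.subspace_scale[OF module_fract J] by auto
  next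
    fix w assume "w \<in> (*) x ` J"
    then obtain v where "w = embed 1 * x * v" "v \<in> J"
      by (auto simp: embed_simps)
    then show "w \<in> {u * v | u v. u \<in> cyclic x \<and> v \<in> J}"
      unfolding cyclic_def by blast
  qed
  have "module.subspace (\<lambda>r. (*) (embed r)) ((*) x ` J)"
  proof (rule module.subspaceI[OF module_fract])
    show "0 \<in> (*) x ` J"
      using module.subspace_0[OF module_fract J] by (auto intro: image_eqI[of _ _ 0])
  next
    fix u v assume "u \<in> (*) x ` J" "v \<in> (*) x ` J"
    then show "u + v \<in> (*) x ` J"
      using module.subspace_add[OF module_fract J] by (auto simp flip: distrib_left)
  next
    fix r v assume "v \<in> (*) x ` J"
    then show "embed r * v \<in> (*) x ` J"
      using module.subspace_scale[OF module_fract J] by (auto simp: mult.left_commute)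
  qed
  then show ?thesis
    unfolding frac_mult_def prods by (simp add: module.span_eq_iff[OF module_fract])
qed

lemma cyclic_mult_cyclic: "cyclic x *\<^sub>f cyclic y = cyclic (x * y)"
  unfolding cyclic_frac_mult[OF subspace_cyclic]
  by (auto simp: cyclic_def mult_ac image_image)

lemma cyclic_mult_add:
  "cyclic x *\<^sub>f (cyclic y +\<^sub>f cyclic z) = cyclic (x * y) +\<^sub>f cyclic (x * z)"
proof -
  have "(*) x ` (cyclic y +\<^sub>f cyclic z) = {x * u + x * v | u v. u \<in> cyclic y \<and> v \<in> cyclic z}"
    by (auto simp: frac_add_def simp flip: distrib_left)
  also have "\<dots> = (*) x ` cyclic y +\<^sub>f (*) x ` cyclic z"
    by (auto simp: frac_add_def)
  finally show ?thesis
    by (simp add: cyclic_frac_mult subspace_cyclic subspace_frac_add flip: cyclic_mult_cyclic)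
qed

lemma frac_inv_cyclic:
  assumes "x \<noteq> 0"
  shows "frac_inv (cyclic x) = cyclic (inverse x)"
proof (intro equalityI subsetI)
  fix z assume "z \<in> frac_inv (cyclic x)"
  then have "z * (embed 1 * x) \<in> range embed"
    unfolding frac_inv_def cyclic_def by blast
  then obtain s where "z * x = embed s"
    by (auto simp: embed_simps)
  then have "z = embed s * inverse x"
    using assms by (simp add: field_simps)
  then show "z \<in> cyclic (inverse x)"
    unfolding cyclic_def by blast
next
  fix z assume "z \<in> cyclic (inverse x)"
  then obtain s where "z = embed s * inverse x"
    by (auto simp: cyclic_def)
  then have "z * (embed r * x) = embed (s * r)" for r
    using assms by (simp add: embed_simps field_simps)
  then show "z \<in> frac_inv (cyclic x)"
    by (auto simp: frac_inv_def cyclic_def)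
qed

lemma frac_pow_cyclic: "frac_pow (cyclic x) n = cyclic (x ^ n)"
proof (induction n)
  case 0
  show ?case by (simp add: cyclic_def)
next
  case (Suc n)
  then show ?case by (simp add: cyclic_mult_cyclic)
qed

lemma frac_powi_cyclic:
  assumes "x \<noteq> 0"
  shows "cyclic x ^\<^sub>f k = cyclic (x powi k)"
  using assms by (simp add: frac_powi_def power_int_def frac_pow_cyclic frac_inv_cyclic)

section \<open>The characterisation\<close>

text \<open>Clearing the denominator \<open>a\<^sup>2\<close> of one summand in the upper bound on \<open>\<cc>\<^sub>1\<close>.\<close>

lemma mem_cyclic_quotient_iff:
  fixes a b c g :: "'a::idom"
  assumes "a \<noteq> 0"
  shows "embed a * embed b * (embed a powi (-2) * embed g) \<in> cyclic (embed c) \<longleftrightarrow>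
    c * a dvd b * g"
proof -
  have nz: "embed a \<noteq> (0 :: 'a fract)"
    using assms by (metis embed_eq_iff embed_simps(1))
  have "embed a * embed b * (embed a powi (-2) * embed g) = embed r * embed c \<longleftrightarrow>
      b * g = c * a * r" for r
  proof -
    have "embed a * embed b * (embed a powi (-2) * embed g) = embed b * embed g / embed a"
      using nz by (simp add: power_int_def power2_eq_square field_simps)
    then have "embed a * embed b * (embed a powi (-2) * embed g) = embed r * embed c \<longleftrightarrow>
        embed (b * g) = embed (c * a * r)"
      using nz by (simp add: embed_simps divide_eq_eq mult_ac)
    then show ?thesis by simp
  qed
  then show ?thesis
    by (auto simp: cyclic_def dvd_def image_iff)
qed

theorem theorem4p4:
  fixes \<aa>1 \<aa>2 \<bb>1 \<bb>2 \<cc>1 \<cc>2 :: "'a::idom set"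
  assumes "principal_ideal_domain TYPE('a)"
    and "is_ideal \<aa>1" "is_ideal \<aa>2" "is_ideal \<bb>1" "is_ideal \<bb>2" "is_ideal \<cc>1" "is_ideal \<cc>2"
    and "\<aa>1 \<noteq> {0}" "\<aa>2 \<noteq> {0}" "\<bb>1 \<noteq> {0}" "\<bb>2 \<noteq> {0}" "\<cc>1 \<noteq> {0}" "\<cc>2 \<noteq> {0}"
  shows "realisable ((\<aa>1, \<aa>2), (\<bb>1, \<bb>2), (\<cc>1, \<cc>2)) \<longleftrightarrow>
    (frac_ideal \<aa>1 ^\<^sub>f 2 dvd\<^sub>f frac_ideal \<aa>2 \<and>
     frac_ideal \<bb>1 ^\<^sub>f 2 dvd\<^sub>f frac_ideal \<bb>2 \<and>
     frac_ideal \<cc>1 ^\<^sub>f 2 dvd\<^sub>f frac_ideal \<cc>2) \<and>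
    frac_ideal \<aa>2 *\<^sub>f frac_ideal \<bb>2 = frac_ideal \<cc>2 \<and>
    (frac_ideal \<aa>1 *\<^sub>f frac_ideal \<bb>1 dvd\<^sub>f frac_ideal \<cc>1 \<and>
     frac_ideal \<cc>1 dvd\<^sub>f
       frac_ideal \<aa>1 *\<^sub>f frac_ideal \<bb>1 *\<^sub>f
         (frac_ideal \<aa>1 ^\<^sub>f (-2) *\<^sub>f frac_ideal \<aa>2 +\<^sub>f
          frac_ideal \<bb>1 ^\<^sub>f (-2) *\<^sub>f frac_ideal \<bb>2))"
proof -
  have gen: "\<exists>g. I = ideal_generated {g} \<and> g \<noteq> 0" if I: "is_ideal I" "I \<noteq> {0}" for I :: "'a set"
  proof -
    obtain g where g: "I = ideal_generated {g}"
      using assms(1) I(1) unfolding principal_ideal_domain_def by blast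
    with I(2) have "g \<noteq> 0"
      by (auto simp: ideal_generated_singleton)
    with g show ?thesis by blast
  qed
  obtain a1 a2 b1 b2 c1 c2 where
    gens: "\<aa>1 = ideal_generated {a1}" "\<aa>2 = ideal_generated {a2}" "\<bb>1 = ideal_generated {b1}"
      "\<bb>2 = ideal_generated {b2}" "\<cc>1 = ideal_generated {c1}" "\<cc>2 = ideal_generated {c2}"
    and nz: "a1 \<noteq> 0" "a2 \<noteq> 0" "b1 \<noteq> 0" "b2 \<noteq> 0" "c1 \<noteq> 0" "c2 \<noteq> 0"
    using gen[OF assms(2,8)] gen[OF assms(3,9)] gen[OF assms(4,10)] gen[OF assms(5,11)]
      gen[OF assms(6,12)] gen[OF assms(7,13)] by blast
  have embed_nz: "embed r \<noteq> (0 :: 'a fract)" if "r \<noteq> 0" for r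
    using that by (metis embed_eq_iff embed_simps(1))
  have sq: "frac_ideal (ideal_generated {r}) ^\<^sub>f 2 dvd\<^sub>f frac_ideal (ideal_generated {s}) \<longleftrightarrow>
      r\<^sup>2 dvd s" if "r \<noteq> 0" for r s :: 'a
  proof -
    have "embed r powi 2 = embed (r\<^sup>2)"
      by (simp add: power_int_def power2_eq_square embed_simps)
    then show ?thesis
      by (simp add: frac_ideal_singleton frac_powi_cyclic embed_nz[OF that] cyclic_dvd_iff
          subspace_cyclic mem_cyclic_embed_iff)
  qed
  have "inj (frac_ideal :: 'a set \<Rightarrow> _)"
    unfolding frac_ideal_def by (auto intro!: injI simp: inj_image_eq_iff inj_def)
  then have dets: "frac_ideal \<aa>2 *\<^sub>f frac_ideal \<bb>2 = frac_ideal \<cc>2 \<longleftrightarrow>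
      ideal_generated {a2 * b2} = ideal_generated {c2}"
    unfolding gens frac_ideal_singleton cyclic_mult_cyclic
    by (simp add: inj_eq flip: embed_simps frac_ideal_singleton)
  have lower: "frac_ideal \<aa>1 *\<^sub>f frac_ideal \<bb>1 dvd\<^sub>f frac_ideal \<cc>1 \<longleftrightarrow> a1 * b1 dvd c1"
    unfolding gens frac_ideal_singleton cyclic_mult_cyclic cyclic_dvd_iff[OF subspace_cyclic]
    by (simp add: mem_cyclic_embed_iff flip: embed_simps)
  have upper: "frac_ideal \<cc>1 dvd\<^sub>f frac_ideal \<aa>1 *\<^sub>f frac_ideal \<bb>1 *\<^sub>f
        (frac_ideal \<aa>1 ^\<^sub>f (-2) *\<^sub>f frac_ideal \<aa>2 +\<^sub>f frac_ideal \<bb>1 ^\<^sub>f (-2) *\<^sub>f frac_ideal \<bb>2) \<longleftrightarrow>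
      c1 * a1 dvd b1 * a2 \<and> c1 * b1 dvd a1 * b2"
    unfolding gens frac_ideal_singleton cyclic_mult_cyclic cyclic_mult_add
      frac_powi_cyclic[OF embed_nz[OF nz(1)]] frac_powi_cyclic[OF embed_nz[OF nz(3)]]
      dvd_cyclic_add_iff[OF subspace_cyclic] mem_cyclic_quotient_iff[OF nz(1)]
      mult.commute[of "embed a1" "embed b1"]
      mem_cyclic_quotient_iff[OF nz(3)]
    by (simp only: mult.commute[of "embed b1" "embed a1"] mem_cyclic_quotient_iff[OF nz(1)])
  show ?thesis
    unfolding dets lower upper unfolding gens sq[OF nz(1)] sq[OF nz(3)] sq[OF nz(5)]
  proof (rule iffI, goal_cases)
    case 1
    then show ?case using realisable_imp_dvd[OF 1] by simp
  next
    case 2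
    then show ?case by (intro dvd_imp_realisable nz) simp_all
  qed
qed

end
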